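(* Consider the Lipschitz experts problem on a metric space $(X,\mathcal{D})$. For each $b>\mathrm{LCD}(X)$, the algorithm $\mathrm{NaiveExp}(b)$ achieves regret $R(t)=O(t^{1-1/(b+2)})$.
   Context: Lipschitz experts problem on $(X,\mathcal{D})$ (diameter at most 1, known): an instance is an unknown Borel probability measure $\mathbb{P}$ on $[0,1]^X$ with $\mu(x)=\mathbb{E}_{f\sim\mathbb{P}}[f(x)]$ $1$-Lipschitz; each round the algorithm picks $x_t$, $f_t\sim\mathbb{P}$ is drawn independently, the algorithm receives $f_t(x_t)$ and may observe $f_t$ at any finite number of points. Regret $R(t)=t\sup\mu-\mathbb{E}[\sum_{s\le t}\mu(x_s)]$. $N_\delta(X)$: smallest number of sets of diameter at most $\delta$ covering $X$; $\mathrm{LCD}(X)=\limsup_{r\to0}\frac{\log\log N_r(X)}{\log(1/r)}$. A set $S\subseteq X$ is a $\delta$-hitting set for $X$ if $X\subseteq\bigcup_{x\in S}B(x,\delta)$, $B(x,\delta)=\{y:\mathcal{D}(x,y)<\delta\}$. Algorithm $\mathrm{NaiveExp}(b)$: runs in phases $i=1,2,\dots$; phase $i$ lasts $T=2^i$ rounds. In phase $i$ it picks a $\delta$-hitting set $S$ for $X$ of size at most $N_\delta(X)$ with $\delta=T^{-1/(b+2)}$, observes the payoffs of all points of $S$ in every round of the phase, and at the end outputs the best guess $x_i^*\in S$ with the highest sample average (ties arbitrary). Throughout phase $i+1$ it plays $x_i^*$.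
   Formalization: A δ-hitting set (open balls) of size at most N_δ(X) may not exist, e.g. for two points at distance exactly δ, leaving NaiveExp(b) undefined; only in a phase where none exists, the algorithm may use a set of that size whose closed δ-balls cover X. *)

theory Defs
  imports "HOL-Probability.Probability"
begin

text \<open>The metric space \<open>(X, D)\<close> is a type \<open>'a\<close> of class \<open>metric_space\<close>; \<open>X\<close> is \<open>UNIV\<close>.\<close>

definition covering_number :: "'a::metric_space set \<Rightarrow> real \<Rightarrow> enat" where
  "covering_number X \<delta> =
     (INF \<A> \<in> {\<A>. finite \<A> \<and> X \<subseteq> \<Union>\<A> \<and> (\<forall>A\<in>\<A>. bounded A \<and> diameter A \<le> \<delta>)}.
        enat (card \<A>))"

text \<open>Extended logarithm with \<open>log 0 = -\<infinity>\<close> and \<open>log \<infinity> = \<infinity>\<close>; the library's real-valued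
  \<open>ln\<close> has \<open>ln 0 = 0\<close>, which is the wrong value for \<open>log (log 1)\<close>.\<close>

definition eln :: "ereal \<Rightarrow> ereal" where
  "eln u = (if u \<le> 0 then - \<infinity> else if u = \<infinity> then \<infinity> else ereal (ln (real_of_ereal u)))"

definition LCD :: "'a::metric_space set \<Rightarrow> ereal" where
  "LCD X = Limsup (at_right 0)
     (\<lambda>r. eln (eln (ereal_of_enat (covering_number X r))) / ereal (ln (1 / r)))"

definition hitting_set :: "'a::metric_space set \<Rightarrow> real \<Rightarrow> 'a set \<Rightarrow> bool" where
  "hitting_set X \<delta> S \<longleftrightarrow> S \<subseteq> X \<and> X \<subseteq> (\<Union>x\<in>S. ball x \<delta>)"

definition small_hitting_set :: "'a::metric_space set \<Rightarrow> real \<Rightarrow> 'a set \<Rightarrow> bool" where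
  "small_hitting_set X \<delta> S \<longleftrightarrow>
     finite S \<and> enat (card S) \<le> covering_number X \<delta> \<and> hitting_set X \<delta> S"

text \<open>The covering number allows sets of diameter exactly \<open>\<delta>\<close>, whereas a hitting set is defined
  with open balls, so a \<open>\<delta>\<close>-hitting set with at most \<open>covering_number X \<delta>\<close> points need not exist
  (two points at distance exactly \<open>\<delta>\<close>). Only when there is none, closed balls are used instead;
  choosing one point from each set of a minimal cover then yields a legal set.\<close>

definition admissible_net :: "'a::metric_space set \<Rightarrow> real \<Rightarrow> 'a set \<Rightarrow> bool" where
  "admissible_net X \<delta> S \<longleftrightarrow>
     small_hitting_set X \<delta> S \<or>
     ((\<nexists>S'. small_hitting_set X \<delta> S') \<and>
      finite S \<and> enat (card S) \<le> covering_number X \<delta> \<and> S \<subseteq> X \<and> X \<subseteq> (\<Union>x\<in>S. cball x \<delta>))"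

definition mean_payoff :: "('a \<Rightarrow> real) measure \<Rightarrow> 'a \<Rightarrow> real" where
  "mean_payoff P x = (\<integral>f. f x \<partial>P)"

text \<open>Here \<open>borel\<close> is the Borel algebra of the product topology on \<open>'a \<Rightarrow> real\<close>, so \<open>P\<close> is a
  Borel measure whose space is \<open>[0,1]\<^sup>X\<close>.\<close>

definition experts_instance :: "('a::metric_space \<Rightarrow> real) measure \<Rightarrow> bool" where
  "experts_instance P \<longleftrightarrow>
     prob_space P \<and> sets P = sets (restrict_space borel (UNIV \<rightarrow> {0..1})) \<and>
     1-lipschitz_on UNIV (mean_payoff P)"

text \<open>Rounds are numbered from 1. The probability space \<open>M\<close> is arbitrary, so it may carry
  randomness beyond the payoff functions \<open>F t\<close>.\<close>

definition iid_payoffs ::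
  "'w measure \<Rightarrow> ('a \<Rightarrow> real) measure \<Rightarrow> (nat \<Rightarrow> 'w \<Rightarrow> 'a \<Rightarrow> real) \<Rightarrow> bool" where
  "iid_payoffs M P F \<longleftrightarrow>
     prob_space M \<and> prob_space.indep_vars M (\<lambda>_. P) F {1..} \<and> (\<forall>t\<ge>1. distr M P (F t) = P)"

text \<open>Phases \<open>1, \<dots>, i - 1\<close> take \<open>2 + \<dots> + 2 ^ (i - 1) = 2 ^ i - 2\<close> rounds.\<close>

definition phase :: "nat \<Rightarrow> nat set" where
  "phase i = {2 ^ i - 1 .. 2 ^ (i + 1) - 2}"

definition sample_average :: "(nat \<Rightarrow> 'w \<Rightarrow> 'a \<Rightarrow> real) \<Rightarrow> nat \<Rightarrow> 'w \<Rightarrow> 'a \<Rightarrow> real" where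
  "sample_average F i \<omega> y = (\<Sum>t\<in>phase i. F t \<omega> y) / 2 ^ i"

text \<open>\<open>S i\<close> is the set picked in phase \<open>i\<close>, \<open>g i\<close> the best guess output at its end, and \<open>x t\<close> the
  point played in round \<open>t\<close>. The description of the algorithm does not say what is played in
  phase 1, so \<open>x t\<close> is an arbitrary random point there. Ties in \<open>g i\<close> are broken arbitrarily, but
  measurably, since otherwise the expected payoff would be undefined.\<close>

definition naive_exp_run ::
  "real \<Rightarrow> 'w measure \<Rightarrow> (nat \<Rightarrow> 'w \<Rightarrow> 'a::metric_space \<Rightarrow> real) \<Rightarrow> (nat \<Rightarrow> 'a set) \<Rightarrow>
   (nat \<Rightarrow> 'w \<Rightarrow> 'a) \<Rightarrow> (nat \<Rightarrow> 'w \<Rightarrow> 'a) \<Rightarrow> bool" where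
  "naive_exp_run b M F S g x \<longleftrightarrow>
     (\<forall>i\<ge>1. admissible_net UNIV ((2 ^ i) powr (- 1 / (b + 2))) (S i)) \<and>
     (\<forall>i\<ge>1. \<forall>\<omega>\<in>space M. g i \<omega> \<in> S i \<and>
        (\<forall>y\<in>S i. sample_average F i \<omega> y \<le> sample_average F i \<omega> (g i \<omega>))) \<and>
     (\<forall>i\<ge>1. \<forall>t\<in>phase (i + 1). \<forall>\<omega>\<in>space M. x t \<omega> = g i \<omega>) \<and>
     (\<forall>t\<ge>1. x t \<in> borel_measurable M)"

definition regret ::
  "'w measure \<Rightarrow> ('a \<Rightarrow> real) measure \<Rightarrow> (nat \<Rightarrow> 'w \<Rightarrow> 'a) \<Rightarrow> nat \<Rightarrow> real" where
  "regret M P x t =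
     real t * (SUP y. mean_payoff P y) - (\<integral>\<omega>. (\<Sum>s=1..t. mean_payoff P (x s \<omega>)) \<partial>M)"

end

theory Submission
  imports Defs
begin

text \<open>There is \<open>A\<close> with \<open>N\<^sub>\<delta> \<le> A * exp (\<delta> powr (- b))\<close> for all \<open>\<delta> > 0\<close>, since \<open>b > LCD\<close> and \<open>N\<^sub>\<delta>\<close> is
  antitone in \<open>\<delta>\<close>. The radius \<open>\<delta>\<close> of a phase with \<open>T\<close> rounds is chosen such that
  \<open>T * \<delta>\<^sup>2 = \<delta> powr (- b)\<close>, so that by Hoeffding's inequality and a union bound over the net all
  sample averages of the phase are \<open>\<delta>\<close>-accurate except with probability
  \<open>2 * A * exp (- (\<delta> powr (- b))) = O(\<delta>)\<close>. Hence each round of the next phase costs \<open>O(\<delta>)\<close>, which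
  for round \<open>s\<close> is \<open>O(s powr (- 1 / (b + 2)))\<close>, and summing over \<open>s\<close> yields the bound. This needs
  \<open>b > 0\<close>; for \<open>b \<le> 0\<close> the space is a single point.\<close>

section \<open>Covering numbers and the log-covering dimension\<close>

lemma covering_number_antimono: "r \<le> s \<Longrightarrow> covering_number X s \<le> covering_number X r"
  unfolding covering_number_def by (rule INF_superset_mono) auto

lemma card_separated_le_covering_number:
  assumes "T \<subseteq> X" and separated: "pairwise (\<lambda>x y. r < dist x y) T"
  shows "enat (card T) \<le> covering_number X r"
  unfolding covering_number_def
proof (rule INF_greatest)
  fix \<A>
  assume "\<A> \<in> {\<A>. finite \<A> \<and> X \<subseteq> \<Union>\<A> \<and> (\<forall>A\<in>\<A>. bounded A \<and> diameter A \<le> r)}"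
  then have fin: "finite \<A>" and cover: "X \<subseteq> \<Union>\<A>"
    and small: "\<And>A. A \<in> \<A> \<Longrightarrow> bounded A" "\<And>A. A \<in> \<A> \<Longrightarrow> diameter A \<le> r"
    by auto
  have "\<forall>x\<in>T. \<exists>A\<in>\<A>. x \<in> A" using cover \<open>T \<subseteq> X\<close> by blast
  then obtain cell where cell: "\<And>x. x \<in> T \<Longrightarrow> cell x \<in> \<A> \<and> x \<in> cell x" by metis
  have "inj_on cell T"
  proof (rule inj_onI)
    fix x y assume xy: "x \<in> T" "y \<in> T" "cell x = cell y"
    then have "dist x y \<le> diameter (cell x)"
      using cell small by (metis diameter_bounded_bound)
    then have "dist x y \<le> r" using cell small(2) xy(1) by fastforce
    then show "x = y" using pairwiseD[OF separated xy(1,2)] by force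
  qed
  then have "card T \<le> card \<A>" using cell fin by (intro card_inj_on_le[of cell]) auto
  then show "enat (card T) \<le> enat (card \<A>)" by simp
qed

lemma eln_le_iff: "eln u \<le> ereal c \<longleftrightarrow> u \<le> ereal (exp c)"
proof (cases u)
  case (real v)
  show ?thesis
  proof (cases "0 < v")
    case True
    then show ?thesis using real by (simp add: eln_def) (metis exp_le_cancel_iff exp_ln)
  next
    case False
    then have "v \<le> exp c" by (meson exp_ge_zero not_less order_trans)
    then show ?thesis using real False by (simp add: eln_def)
  qed
qed (simp_all add: eln_def)

lemma eventually_covering_number_le_exp:
  assumes "LCD X < ereal b"
  shows "\<forall>\<^sub>F r in at_right 0. ereal_of_enat (covering_number X r) \<le> ereal (exp (r powr (- b)))"
proof -
  have "\<forall>\<^sub>F r in at_right 0.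
      eln (eln (ereal_of_enat (covering_number X r))) / ereal (ln (1 / r)) < ereal b"
    using assms unfolding LCD_def by (rule Limsup_lessD)
  moreover have "\<forall>\<^sub>F r::real in at_right 0. r \<in> {0<..<1}"
    by (rule eventually_at_right_real) simp
  ultimately show ?thesis
  proof eventually_elim
    case (elim r)
    then have "eln (eln (ereal_of_enat (covering_number X r))) < ereal b * ereal (ln (1 / r))"
      by (subst (asm) ereal_divide_less_iff) auto
    then have "eln (eln (ereal_of_enat (covering_number X r))) \<le> ereal (b * ln (1 / r))"
      by simp
    then have "ereal_of_enat (covering_number X r) \<le> ereal (exp (exp (b * ln (1 / r))))"
      by (simp only: eln_le_iff)
    moreover have "exp (b * ln (1 / r)) = r powr (- b)"
      using elim by (simp add: powr_def ln_div)
    ultimately show ?case by simp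
  qed
qed

lemma covering_number_le_exp:
  assumes "LCD X < ereal b"
  obtains A where "0 \<le> A"
    "\<And>r. 0 < r \<Longrightarrow> ereal_of_enat (covering_number X r) \<le> ereal (A * exp (r powr (- b)))"
proof -
  obtain r0 where "0 < r0" and small:
    "\<And>r. 0 < r \<Longrightarrow> r < r0 \<Longrightarrow> ereal_of_enat (covering_number X r) \<le> ereal (exp (r powr (- b)))"
    using eventually_covering_number_le_exp[OF assms] unfolding eventually_at_right_field by blast
  define A where "A = exp ((r0 / 2) powr (- b))"
  have "1 \<le> A" by (simp add: A_def)
  have "ereal_of_enat (covering_number X r) \<le> ereal (A * exp (r powr (- b)))" if "0 < r" for r
  proof (cases "r < r0")
    case True
    have "exp (r powr (- b)) \<le> A * exp (r powr (- b))" using \<open>1 \<le> A\<close> by simp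
    then show ?thesis using small[OF that True] by (meson ereal_less_eq(3) order_trans)
  next
    case False
    then have "covering_number X r \<le> covering_number X (r0 / 2)"
      using \<open>0 < r0\<close> by (intro covering_number_antimono) simp
    also have "ereal_of_enat (covering_number X (r0 / 2)) \<le> ereal A"
      using small[of "r0 / 2"] \<open>0 < r0\<close> by (simp add: A_def)
    also have "A \<le> A * exp (r powr (- b))" using \<open>1 \<le> A\<close> by simp
    finally show ?thesis by simp
  qed
  then show thesis using that[of A] \<open>1 \<le> A\<close> by simp
qed

lemma LCD_nonneg:
  assumes "x \<in> X" "y \<in> X" "x \<noteq> y"
  shows "0 \<le> LCD X"
proof (rule ccontr)
  assume "\<not> 0 \<le> LCD X"
  then obtain c where c: "LCD X < ereal c" "c < 0"
    using ereal_dense2[of "LCD X" 0] by (auto simp: not_le)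
  have "((\<lambda>r. exp (r powr (- c))) \<longlongrightarrow> exp (0 powr (- c))) (at_right 0)"
    using c(2) eventually_at_right_less[of "0::real"]
    by (intro tendsto_exp tendsto_powr' tendsto_intros) (auto elim: eventually_mono)
  then have "\<forall>\<^sub>F r in at_right 0. exp (r powr (- c)) < 2"
    by (rule order_tendstoD) simp
  moreover have "\<forall>\<^sub>F r in at_right 0. r \<in> {0<..<dist x y}"
    using assms(3) by (intro eventually_at_right_real) simp
  moreover note eventually_covering_number_le_exp[OF c(1)]
  ultimately have "\<forall>\<^sub>F r::real in at_right 0. False"
  proof eventually_elim
    case (elim r)
    then have "pairwise (\<lambda>u v. r < dist u v) {x, y}" by (simp add: pairwise_insert dist_commute)
    then have "enat (card {x, y}) \<le> covering_number X r"
      using assms by (intro card_separated_le_covering_number) auto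
    then have "ereal_of_enat (enat (card {x, y})) \<le> ereal_of_enat (covering_number X r)"
      by (simp only: ereal_of_enat_le_iff)
    also note elim(3)
    finally show ?case using elim(1) assms(3) by simp
  qed
  then show False by simp
qed

lemma admissible_net_finite: "admissible_net X \<delta> S \<Longrightarrow> finite S"
  and admissible_net_card_le: "admissible_net X \<delta> S \<Longrightarrow> enat (card S) \<le> covering_number X \<delta>"
  unfolding admissible_net_def small_hitting_set_def by argo+

lemma admissible_net_subset_cball:
  assumes "admissible_net X \<delta> S"
  shows "X \<subseteq> (\<Union>y\<in>S. cball y \<delta>)"
  using assms unfolding admissible_net_def small_hitting_set_def hitting_set_def
  by (fastforce simp: subset_iff intro: less_imp_le)


section \<open>Two inequalities for real powers\<close>

lemma exp_minus_powr_le: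
  fixes b r :: real
  assumes "0 < b" "0 < r"
  shows "exp (- (r powr (- b))) \<le> (exp 1 * b) powr (- 1 / b) * r"
proof -
  define u where "u = r powr (- b)"
  have "0 < u" using assms by (simp add: u_def)
  have "b * u \<le> exp (b * u - 1)" using exp_ge_add_one_self[of "b * u - 1"] by simp
  then have "exp 1 * b * u \<le> exp (b * u)" by (simp add: exp_diff field_simps)
  then have "exp (b * u) powr (- 1 / b) \<le> (exp 1 * b * u) powr (- 1 / b)"
    using assms \<open>0 < u\<close> by (intro powr_mono2') auto
  also have "exp (b * u) powr (- 1 / b) = exp (- u)" using assms by (simp add: powr_def)
  also have "(exp 1 * b * u) powr (- 1 / b) = (exp 1 * b) powr (- 1 / b) * r"
    using assms by (simp add: u_def powr_mult powr_powr)
  finally show ?thesis by (simp add: u_def)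
qed

lemma sum_powr_minus_le:
  fixes a :: real
  assumes "0 \<le> a" "a < 1"
  shows "(\<Sum>s=1..t. real s powr (- a)) \<le> real t powr (1 - a) / (1 - a)"
proof (induction t)
  case (Suc n)
  have "real n powr (1 - a) * (1 + real n) powr a \<le> (1 - a) * real n + a * (1 + real n)"
    using assms Youngs_inequality_0[of "1 - a" a "real n" "1 + real n"] by (cases "n = 0") auto
  also have "\<dots> = (1 + real n) - (1 - a)" by (simp add: algebra_simps)
  finally have "real n powr (1 - a) * ((1 + real n) powr a * (1 + real n) powr (- a))
      \<le> (1 + real n) * (1 + real n) powr (- a) - (1 - a) * (1 + real n) powr (- a)"
    unfolding mult.assoc[symmetric] left_diff_distrib[symmetric] by (intro mult_right_mono) auto
  then have "real n powr (1 - a) \<le> (1 + real n) powr (1 - a) - (1 - a) * (1 + real n) powr (- a)"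
    by (simp add: powr_mult_base flip: powr_add)
  then have "real (Suc n) powr (- a) \<le> (real (Suc n) powr (1 - a) - real n powr (1 - a)) / (1 - a)"
    using assms by (simp add: field_simps)
  with Suc.IH show ?case by (simp add: diff_divide_distrib)
qed simp


section \<open>Phases\<close>

lemma card_phase: "card (phase i) = 2 ^ i"
proof -
  have "(1::nat) \<le> 2 ^ i" by simp
  then show ?thesis unfolding phase_def card_atLeastAtMost power_add power_one_right by linarith
qed

lemma phase_subset_atLeast_1: "1 \<le> i \<Longrightarrow> phase i \<subseteq> {1..}"
  using power_increasing[of 1 i "2::nat"] by (auto simp: phase_def)

lemma ex_phase:
  assumes "1 \<le> t"
  shows "\<exists>i\<ge>1. t \<in> phase i"
proof -
  obtain n where n: "2 ^ n \<le> t + 1" "t + 1 < 2 ^ (n + 1)"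
    using ex_power_ivl1[of 2 "t + 1"] by auto
  have "n \<noteq> 0" using n(2) assms by (cases n) auto
  moreover have "t \<in> phase n" using n by (auto simp: phase_def)
  ultimately show ?thesis by (intro exI[of _ n]) simp
qed

lemma less_if_mem_phase: "t \<in> phase i \<Longrightarrow> t < 2 ^ (i + 1)"
proof -
  assume "t \<in> phase i"
  moreover have "(0::nat) < 2 ^ (i + 1)" by simp
  ultimately show ?thesis unfolding phase_def atLeastAtMost_iff by linarith
qed

definition phase_radius :: "real \<Rightarrow> nat \<Rightarrow> real" where
  "phase_radius b i = (2 ^ i) powr (- 1 / (b + 2))"

lemma phase_radius_pos: "0 < phase_radius b i"
  by (simp add: phase_radius_def)

lemma phase_length_times_radius_squared:
  assumes "b \<noteq> - 2"
  shows "2 ^ i * (phase_radius b i)\<^sup>2 = phase_radius b i powr (- b)"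
proof -
  have "2 ^ i * (phase_radius b i)\<^sup>2 = (2 ^ i) powr (1 + (- 1 / (b + 2)) * 2)"
    unfolding powr_add by (simp add: phase_radius_def powr_powr flip: powr_numeral)
  also have "1 + (- 1 / (b + 2)) * 2 = (- 1 / (b + 2)) * (- b)"
    using assms by (simp add: field_simps)
  finally show ?thesis by (simp add: phase_radius_def powr_powr)
qed

lemma phase_radius_le:
  assumes "0 \<le> b" "s \<in> phase (i + 1)"
  shows "phase_radius b i \<le> 2 * real s powr (- 1 / (b + 2))"
proof -
  define a where "a = 1 / (b + 2)"
  have a: "0 \<le> a" "a \<le> 1 / 2" using assms(1) by (auto simp: a_def field_simps)
  have "1 \<le> s" using phase_subset_atLeast_1[of "i + 1"] assms(2) by auto
  have "real s < real (2 ^ (i + 1 + 1))"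
    using less_if_mem_phase[OF assms(2)] by (simp only: of_nat_less_iff)
  then have "real s \<le> 4 * 2 ^ i" by simp
  have "1 / 2 = (4::real) powr (- (1 / 2))" by (simp add: powr_minus powr_half_sqrt)
  also have "\<dots> \<le> 4 powr (- a)" using a by (intro powr_mono) auto
  finally have "1 / 2 * (2 ^ i) powr (- a) \<le> 4 powr (- a) * (2 ^ i) powr (- a)"
    by (intro mult_right_mono) auto
  also have "\<dots> = (4 * 2 ^ i) powr (- a)" by (simp add: powr_mult)
  also have "\<dots> \<le> real s powr (- a)"
    using \<open>real s \<le> 4 * 2 ^ i\<close> \<open>1 \<le> s\<close> a by (intro powr_mono2') auto
  finally have "1 / 2 * (2 ^ i) powr (- a) \<le> real s powr (- a)" .
  then show ?thesis by (simp add: phase_radius_def a_def)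
qed


section \<open>Lipschitz experts\<close>

lemma lipschitz_le_argmax_on_net:
  fixes f h :: "'a::metric_space \<Rightarrow> real"
  assumes lip: "L-lipschitz_on X f" and "S \<subseteq> X" and net: "X \<subseteq> (\<Union>y\<in>S. cball y \<delta>)"
    and accurate: "\<And>y. y \<in> S \<Longrightarrow> \<bar>h y - f y\<bar> \<le> \<epsilon>"
    and argmax: "s \<in> S" "\<And>y. y \<in> S \<Longrightarrow> h y \<le> h s"
    and "z \<in> X"
  shows "f z \<le> f s + L * \<delta> + 2 * \<epsilon>"
proof -
  obtain y where y: "y \<in> S" "dist z y \<le> \<delta>" using net \<open>z \<in> X\<close> by (auto simp: dist_commute)
  have "f z - f y \<le> L * dist z y"
    using lipschitz_onD[OF lip \<open>z \<in> X\<close>, of y] y \<open>S \<subseteq> X\<close> by (auto simp: dist_real_def)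
  also have "\<dots> \<le> L * \<delta>" using y lipschitz_on_nonneg[OF lip] by (intro mult_left_mono)
  finally show ?thesis
    using accurate[OF y(1)] accurate[OF argmax(1)] argmax(2)[OF y(1)] by linarith
qed

definition suboptimality :: "('a \<Rightarrow> real) measure \<Rightarrow> 'a \<Rightarrow> real" where
  "suboptimality P y = (SUP z. mean_payoff P z) - mean_payoff P y"

locale lipschitz_experts =
  fixes P :: "('a::metric_space \<Rightarrow> real) measure"
  assumes experts_instance: "experts_instance P"
begin

sublocale payoff: prob_space P
  using experts_instance by (simp add: experts_instance_def)

lemma sets_payoff: "sets P = sets (restrict_space borel (UNIV \<rightarrow> {0..1}))"
  using experts_instance by (simp add: experts_instance_def)

lemma space_payoff: "space P = UNIV \<rightarrow> {0..1}"
  using sets_eq_imp_space_eq[OF sets_payoff] by (simp add: space_restrict_space)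

lemma measurable_eval [measurable]: "(\<lambda>f. f y) \<in> borel_measurable P"
  unfolding measurable_cong_sets[OF sets_payoff refl]
  by (intro measurable_restrict_space1 measurable_product_coordinates)

lemma mean_payoff_bounds: "0 \<le> mean_payoff P y" "mean_payoff P y \<le> 1"
proof -
  have unit: "f y \<in> {0..1}" if "f \<in> space P" for f
    using that by (auto simp: space_payoff Pi_iff)
  then have "integrable P (\<lambda>f. f y)"
    by (intro payoff.integrable_const_bound[of _ 1] AE_I2) auto
  then show "mean_payoff P y \<le> 1"
    unfolding mean_payoff_def using unit by (intro payoff.integral_le_const AE_I2) auto
  show "0 \<le> mean_payoff P y"
    unfolding mean_payoff_def using unit by (intro integral_nonneg_AE AE_I2) auto
qed

lemma lipschitz_mean_payoff: "1-lipschitz_on UNIV (mean_payoff P)"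
  using experts_instance by (simp add: experts_instance_def)

lemma measurable_suboptimality [measurable]: "suboptimality P \<in> borel_measurable borel"
  unfolding suboptimality_def
  by (intro borel_measurable_continuous_onI continuous_intros
      lipschitz_on_continuous_on[OF lipschitz_mean_payoff])

lemma suboptimality_bounds: "0 \<le> suboptimality P y" "suboptimality P y \<le> 1"
proof -
  have "bdd_above (range (mean_payoff P))"
    using mean_payoff_bounds by (intro bdd_aboveI[of _ 1]) auto
  then show "0 \<le> suboptimality P y"
    unfolding suboptimality_def using cSUP_upper[of y UNIV "mean_payoff P"] by simp
  have "(SUP z. mean_payoff P z) \<le> 1" using mean_payoff_bounds by (intro cSUP_least) auto
  then show "suboptimality P y \<le> 1"
    unfolding suboptimality_def using mean_payoff_bounds(1)[of y] by simp
qed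

lemma suboptimality_argmax_on_net_le:
  assumes "UNIV \<subseteq> (\<Union>y\<in>S. cball y \<delta>)" "\<And>y. y \<in> S \<Longrightarrow> \<bar>h y - mean_payoff P y\<bar> \<le> \<epsilon>"
    and "s \<in> S" "\<And>y. y \<in> S \<Longrightarrow> h y \<le> h s"
  shows "suboptimality P s \<le> \<delta> + 2 * \<epsilon>"
proof -
  have "mean_payoff P z \<le> mean_payoff P s + 1 * \<delta> + 2 * \<epsilon>" for z
    using assms by (intro lipschitz_le_argmax_on_net[OF lipschitz_mean_payoff, of S \<delta> h]) auto
  then have "(SUP z. mean_payoff P z) \<le> mean_payoff P s + 1 * \<delta> + 2 * \<epsilon>"
    by (intro cSUP_least) auto
  then show ?thesis by (simp add: suboptimality_def)
qed

end

locale lipschitz_experts_play = lipschitz_experts P + prob_space M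
  for P :: "('a::metric_space \<Rightarrow> real) measure" and M :: "'w measure"
begin

lemma integrable_suboptimality:
  assumes [measurable]: "y \<in> borel_measurable M"
  shows "integrable M (\<lambda>\<omega>. suboptimality P (y \<omega>))"
  using suboptimality_bounds by (intro integrable_const_bound[of _ 1]) auto

lemma expected_suboptimality_bounds:
  assumes "y \<in> borel_measurable M"
  shows "0 \<le> expectation (\<lambda>\<omega>. suboptimality P (y \<omega>))"
    and "expectation (\<lambda>\<omega>. suboptimality P (y \<omega>)) \<le> 1"
  using suboptimality_bounds integrable_suboptimality[OF assms]
  by (auto intro!: integral_le_const)

lemma regret_eq_sum_suboptimality:
  assumes "\<And>s. 1 \<le> s \<Longrightarrow> x s \<in> borel_measurable M"
  shows "regret M P x t = (\<Sum>s=1..t. expectation (\<lambda>\<omega>. suboptimality P (x s \<omega>)))"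
proof -
  define best where "best = (SUP z. mean_payoff P z)"
  have "(\<integral>\<omega>. (\<Sum>s=1..t. mean_payoff P (x s \<omega>)) \<partial>M)
      = (\<integral>\<omega>. real t * best - (\<Sum>s=1..t. suboptimality P (x s \<omega>)) \<partial>M)"
    by (simp add: suboptimality_def best_def sum_subtractf)
  also have "\<dots> = real t * best - (\<Sum>s=1..t. expectation (\<lambda>\<omega>. suboptimality P (x s \<omega>)))"
    using integrable_suboptimality assms
    by (subst Bochner_Integration.integral_diff) (auto simp: prob_space integral_sum)
  finally show ?thesis by (simp add: regret_def best_def)
qed

end


lemma (in prob_space) regret_eq_0_if_subsingleton:
  fixes P :: "('b::metric_space \<Rightarrow> real) measure"
  assumes "\<And>u v :: 'b. u = v"
  shows "regret M P x t = 0"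
proof -
  obtain c where "\<And>y. mean_payoff P y = c" using assms by metis
  then show ?thesis by (simp add: regret_def prob_space)
qed


section \<open>The best guess of a phase\<close>

lemma (in prob_space) expectation_le_add_prob:
  fixes X :: "'a \<Rightarrow> real"
  assumes "integrable M X" "B \<in> events"
    and bound: "\<And>\<omega>. \<omega> \<in> space M \<Longrightarrow> X \<omega> \<le> c + indicator B \<omega>"
  shows "expectation X \<le> c + prob B"
proof -
  have "integrable M (indicator B :: 'a \<Rightarrow> real)"
    using \<open>B \<in> events\<close> by (simp add: integrable_indicator_iff emeasure_eq_measure)
  then have "expectation X \<le> expectation (\<lambda>\<omega>. c + indicator B \<omega>)"
    using assms by (intro integral_mono) auto
  also have "\<dots> = c + prob B"
    using \<open>integrable M (indicator B)\<close> \<open>B \<in> events\<close> by (simp add: prob_space)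
  finally show ?thesis .
qed

locale iid_experts = lipschitz_experts_play P M
  for P :: "('a::metric_space \<Rightarrow> real) measure" and M :: "'w measure" +
  fixes F :: "nat \<Rightarrow> 'w \<Rightarrow> 'a \<Rightarrow> real"
  assumes iid_payoffs: "iid_payoffs M P F"
begin

lemma indep_payoffs: "indep_vars (\<lambda>_. P) F {1..}"
  and distr_payoff: "1 \<le> t \<Longrightarrow> distr M P (F t) = P"
  using iid_payoffs by (auto simp: iid_payoffs_def)

lemma measurable_payoff: "1 \<le> t \<Longrightarrow> F t \<in> measurable M P"
  using indep_payoffs by (auto simp: indep_vars_def)

lemma measurable_payoff_eval: "1 \<le> t \<Longrightarrow> (\<lambda>\<omega>. F t \<omega> y) \<in> borel_measurable M"
  using measurable_compose[OF measurable_payoff measurable_eval] .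

lemma distr_payoff_eval:
  assumes "1 \<le> t"
  shows "distr M borel (\<lambda>\<omega>. F t \<omega> y) = distr P borel (\<lambda>f. f y)"
  using distr_distr[OF measurable_eval measurable_payoff[OF assms], of y] distr_payoff[OF assms]
  by (simp add: comp_def)

lemma expectation_payoff_eval:
  assumes "1 \<le> t"
  shows "expectation (\<lambda>\<omega>. F t \<omega> y) = mean_payoff P y"
  using integral_distr[OF measurable_payoff[OF assms] measurable_eval] distr_payoff[OF assms]
  by (simp add: mean_payoff_def)

definition inaccurate :: "nat \<Rightarrow> real \<Rightarrow> 'a \<Rightarrow> 'w set" where
  "inaccurate i \<epsilon> y = {\<omega>\<in>space M. \<epsilon> \<le> \<bar>sample_average F i \<omega> y - mean_payoff P y\<bar>}"

lemma inaccurate_in_events: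
  assumes "1 \<le> i"
  shows "inaccurate i \<epsilon> y \<in> events"
proof -
  have [measurable]: "(\<lambda>\<omega>. sample_average F i \<omega> y) \<in> borel_measurable M"
    unfolding sample_average_def using phase_subset_atLeast_1[OF assms]
    by (intro borel_measurable_divide borel_measurable_sum measurable_payoff_eval) auto
  show ?thesis unfolding inaccurate_def by measurable
qed

lemma prob_inaccurate_le:
  assumes "1 \<le> i" "0 \<le> \<epsilon>"
  shows "prob (inaccurate i \<epsilon> y) \<le> 2 * exp (- 2 * 2 ^ i * \<epsilon>\<^sup>2)"
proof -
  note rounds = phase_subset_atLeast_1[OF assms(1)]
  have "indep_vars (\<lambda>_. borel) (\<lambda>t \<omega>. F t \<omega> y) {1..}"
    using indep_vars_compose2[OF indep_payoffs, of "\<lambda>_ f. f y" "\<lambda>_. borel"] by simp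
  then have "indep_vars (\<lambda>_. borel) (\<lambda>t \<omega>. F t \<omega> y) (phase i)"
    using rounds by (rule indep_vars_subset)
  moreover have "F 1 \<omega> y \<in> {0..1}" if "\<omega> \<in> space M" for \<omega>
    using measurable_space[OF measurable_payoff that, of 1] by (auto simp: space_payoff Pi_iff)
  ultimately interpret hoeffding: Hoeffding_ineq_iid M "phase i" "\<lambda>t \<omega>. F t \<omega> y" "\<lambda>\<omega>. F 1 \<omega> y" 0 1
    "mean_payoff P y"
    using rounds
    by unfold_locales (auto simp: phase_def distr_payoff_eval subset_iff expectation_payoff_eval
        measurable_payoff_eval)
  have "phase i \<noteq> {}" using card_phase[of i] by force
  then show ?thesis
    using hoeffding.Hoeffding_ineq_abs_ge'[OF assms(2)]
    by (simp add: inaccurate_def sample_average_def card_phase)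
qed

lemma expected_suboptimality_best_guess_le:
  assumes "1 \<le> i" "0 \<le> \<delta>" "0 \<le> \<epsilon>" and S: "finite S" "UNIV \<subseteq> (\<Union>y\<in>S. cball y \<delta>)"
    and guess: "\<And>\<omega>. \<omega> \<in> space M \<Longrightarrow> guess \<omega> \<in> S"
      "\<And>\<omega> y. \<omega> \<in> space M \<Longrightarrow> y \<in> S \<Longrightarrow> sample_average F i \<omega> y \<le> sample_average F i \<omega> (guess \<omega>)"
      "guess \<in> borel_measurable M"
  shows "expectation (\<lambda>\<omega>. suboptimality P (guess \<omega>))
    \<le> \<delta> + 2 * \<epsilon> + 2 * real (card S) * exp (- 2 * 2 ^ i * \<epsilon>\<^sup>2)"
proof -
  define bad where "bad = (\<Union>y\<in>S. inaccurate i \<epsilon> y)"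
  have "suboptimality P (guess \<omega>) \<le> \<delta> + 2 * \<epsilon> + indicator bad \<omega>" if "\<omega> \<in> space M" for \<omega>
  proof (cases "\<omega> \<in> bad")
    case True
    then show ?thesis using suboptimality_bounds(2)[of "guess \<omega>"] \<open>0 \<le> \<delta>\<close> \<open>0 \<le> \<epsilon>\<close> by simp
  next
    case False
    then have "\<bar>sample_average F i \<omega> y - mean_payoff P y\<bar> \<le> \<epsilon>" if "y \<in> S" for y
      using that \<open>\<omega> \<in> space M\<close> by (force simp: bad_def inaccurate_def)
    then have "suboptimality P (guess \<omega>) \<le> \<delta> + 2 * \<epsilon>"
      using suboptimality_argmax_on_net_le[OF S(2)] guess(1,2)[OF that] by blast
    then show ?thesis using False by simp
  qed
  moreover have "bad \<in> events"
    unfolding bad_def using \<open>finite S\<close> inaccurate_in_events[OF \<open>1 \<le> i\<close>] by blast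
  ultimately have "expectation (\<lambda>\<omega>. suboptimality P (guess \<omega>)) \<le> \<delta> + 2 * \<epsilon> + prob bad"
    using integrable_suboptimality[OF guess(3)] by (intro expectation_le_add_prob)
  also have "prob bad \<le> (\<Sum>y\<in>S. prob (inaccurate i \<epsilon> y))"
    unfolding bad_def using \<open>finite S\<close> inaccurate_in_events[OF \<open>1 \<le> i\<close>]
    by (intro finite_measure_subadditive_finite) auto
  also have "\<dots> \<le> real (card S) * (2 * exp (- 2 * 2 ^ i * \<epsilon>\<^sup>2))"
    using \<open>1 \<le> i\<close> \<open>0 \<le> \<epsilon>\<close> by (intro sum_bounded_above prob_inaccurate_le)
  finally show ?thesis by (simp add: mult_ac)
qed

end


section \<open>Regret of the algorithm\<close>

definition suboptimality_const :: "real \<Rightarrow> real \<Rightarrow> real" where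
  "suboptimality_const b A = 3 + 2 * A * (exp 1 * b) powr (- 1 / b)"

locale naive_exp = iid_experts P M F
  for P :: "('a::metric_space \<Rightarrow> real) measure" and M :: "'w measure" and F +
  fixes b A :: real and S :: "nat \<Rightarrow> 'a set" and g x :: "nat \<Rightarrow> 'w \<Rightarrow> 'a"
  assumes b_pos: "0 < b" and A_nonneg: "0 \<le> A"
    and covering: "\<And>r. 0 < r \<Longrightarrow>
      ereal_of_enat (covering_number (UNIV :: 'a set) r) \<le> ereal (A * exp (r powr (- b)))"
    and run: "naive_exp_run b M F S g x"
begin

lemma three_le_suboptimality_const: "3 \<le> suboptimality_const b A"
  using A_nonneg by (simp add: suboptimality_const_def)

lemma admissible_net_S: "1 \<le> i \<Longrightarrow> admissible_net UNIV (phase_radius b i) (S i)"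
  and guess_in_net: "1 \<le> i \<Longrightarrow> \<omega> \<in> space M \<Longrightarrow> g i \<omega> \<in> S i"
  and guess_argmax: "1 \<le> i \<Longrightarrow> \<omega> \<in> space M \<Longrightarrow> y \<in> S i \<Longrightarrow>
    sample_average F i \<omega> y \<le> sample_average F i \<omega> (g i \<omega>)"
  and play_eq_guess: "1 \<le> i \<Longrightarrow> s \<in> phase (i + 1) \<Longrightarrow> \<omega> \<in> space M \<Longrightarrow> x s \<omega> = g i \<omega>"
  and measurable_play: "1 \<le> s \<Longrightarrow> x s \<in> borel_measurable M"
  using run unfolding naive_exp_run_def phase_radius_def by blast+

lemma card_net_times_exp_le:
  assumes "1 \<le> i"
  defines "\<delta> \<equiv> phase_radius b i"
  shows "real (card (S i)) * exp (- 2 * 2 ^ i * \<delta>\<^sup>2) \<le> A * (exp 1 * b) powr (- 1 / b) * \<delta>"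
proof -
  have "0 < \<delta>" by (simp add: \<delta>_def phase_radius_pos)
  have "ereal_of_enat (enat (card (S i))) \<le> ereal_of_enat (covering_number (UNIV :: 'a set) \<delta>)"
    unfolding ereal_of_enat_le_iff \<delta>_def using admissible_net_S[OF assms(1)] by (rule admissible_net_card_le)
  also note covering[OF \<open>0 < \<delta>\<close>]
  finally have card: "real (card (S i)) \<le> A * exp (\<delta> powr (- b))" by simp
  have "- 2 * 2 ^ i * \<delta>\<^sup>2 = - (\<delta> powr (- b)) - \<delta> powr (- b)"
    using phase_length_times_radius_squared[of b i] b_pos by (simp add: \<delta>_def)
  then have "real (card (S i)) * exp (- 2 * 2 ^ i * \<delta>\<^sup>2)
      \<le> A * exp (\<delta> powr (- b)) * exp (- (\<delta> powr (- b)) - \<delta> powr (- b))"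
    using card by (simp only:) (intro mult_right_mono, auto)
  also have "\<dots> = A * exp (- (\<delta> powr (- b)))"
    by (simp add: mult.assoc flip: exp_add)
  also have "\<dots> \<le> A * ((exp 1 * b) powr (- 1 / b) * \<delta>)"
    using A_nonneg b_pos \<open>0 < \<delta>\<close> by (intro mult_left_mono exp_minus_powr_le)
  finally show ?thesis by (simp add: mult.assoc)
qed

lemma expected_suboptimality_le_phase_radius:
  assumes "1 \<le> i" "s \<in> phase (i + 1)"
  shows "expectation (\<lambda>\<omega>. suboptimality P (x s \<omega>)) \<le> suboptimality_const b A * phase_radius b i"
proof -
  let ?\<delta> = "phase_radius b i"
  have "1 \<le> s" using phase_subset_atLeast_1[of "i + 1"] assms(2) by auto
  have "expectation (\<lambda>\<omega>. suboptimality P (x s \<omega>))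
      \<le> ?\<delta> + 2 * ?\<delta> + 2 * real (card (S i)) * exp (- 2 * 2 ^ i * ?\<delta>\<^sup>2)"
    using admissible_net_finite[OF admissible_net_S] admissible_net_subset_cball[OF admissible_net_S]
    by (intro expected_suboptimality_best_guess_le)
      (use assms \<open>1 \<le> s\<close> phase_radius_pos[of b i] in
        \<open>auto simp: play_eq_guess guess_in_net guess_argmax measurable_play\<close>)
  also have "\<dots> \<le> suboptimality_const b A * ?\<delta>"
    using card_net_times_exp_le[OF assms(1)] by (simp add: suboptimality_const_def algebra_simps)
  finally show ?thesis .
qed

lemma expected_suboptimality_le_powr:
  assumes "1 \<le> s"
  shows "expectation (\<lambda>\<omega>. suboptimality P (x s \<omega>))
    \<le> 2 * suboptimality_const b A * real s powr (- 1 / (b + 2))"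
proof -
  obtain i where i: "s \<in> phase (i + 1)"
    using ex_phase[OF assms] by (metis add.commute le_Suc_ex)
  have "expectation (\<lambda>\<omega>. suboptimality P (x s \<omega>)) \<le> suboptimality_const b A * phase_radius b i"
  proof (cases "i = 0")
    case True
    then show ?thesis
      using expected_suboptimality_bounds(2)[OF measurable_play[OF assms]] three_le_suboptimality_const
      by (simp add: phase_radius_def)
  next
    case False
    then show ?thesis using i by (intro expected_suboptimality_le_phase_radius) auto
  qed
  also have "\<dots> \<le> suboptimality_const b A * (2 * real s powr (- 1 / (b + 2)))"
    using i b_pos three_le_suboptimality_const by (intro mult_left_mono phase_radius_le) auto
  finally show ?thesis by (simp add: mult_ac)
qed

lemma abs_regret_le: "\<bar>regret M P x t\<bar> \<le> 4 * suboptimality_const b A * real t powr (1 - 1 / (b + 2))"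
proof -
  define a where "a = 1 / (b + 2)"
  have a: "0 \<le> a" "a \<le> 1 / 2" using b_pos by (auto simp: a_def field_simps)
  have "\<bar>regret M P x t\<bar> = (\<Sum>s=1..t. expectation (\<lambda>\<omega>. suboptimality P (x s \<omega>)))"
    using expected_suboptimality_bounds(1)[OF measurable_play]
    by (subst regret_eq_sum_suboptimality[OF measurable_play])
      (auto intro!: abs_of_nonneg sum_nonneg)
  also have "\<dots> \<le> (\<Sum>s=1..t. 2 * suboptimality_const b A * real s powr (- a))"
    unfolding a_def minus_divide_left by (intro sum_mono expected_suboptimality_le_powr) simp
  also have "\<dots> = 2 * suboptimality_const b A * (\<Sum>s=1..t. real s powr (- a))"
    by (simp add: sum_distrib_left)
  also have "\<dots> \<le> 2 * suboptimality_const b A * (real t powr (1 - a) / (1 - a))"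
    using a three_le_suboptimality_const by (intro mult_left_mono sum_powr_minus_le) auto
  also have "\<dots> \<le> 2 * suboptimality_const b A * (real t powr (1 - a) / (1 / 2))"
    using a three_le_suboptimality_const by (intro mult_left_mono divide_left_mono) auto
  finally show ?thesis by (simp add: a_def)
qed

end

theorem theorem9p1:
  fixes b :: real
  assumes "bounded (UNIV :: 'a::metric_space set)"
    and "diameter (UNIV :: 'a set) \<le> 1"
    and "LCD (UNIV :: 'a set) < ereal b"
  shows "\<exists>C. \<forall>(P :: ('a \<Rightarrow> real) measure) (M :: 'w measure) F S g x.
           experts_instance P \<longrightarrow> iid_payoffs M P F \<longrightarrow> naive_exp_run b M F S g x \<longrightarrow>
           (\<forall>t\<ge>1. \<bar>regret M P x t\<bar> \<le> C * real t powr (1 - 1 / (b + 2)))"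
proof (cases "\<exists>u v :: 'a. u \<noteq> v")
  case True
  then have "0 < ereal b" using LCD_nonneg assms(3) by (meson UNIV_I le_less_trans)
  then have "0 < b" by simp
  obtain A where A: "0 \<le> A" "\<And>r. 0 < r \<Longrightarrow>
      ereal_of_enat (covering_number (UNIV :: 'a set) r) \<le> ereal (A * exp (r powr (- b)))"
    using covering_number_le_exp[OF assms(3)] by blast
  show ?thesis
  proof (intro exI allI impI)
    fix P :: "('a \<Rightarrow> real) measure" and M :: "'w measure" and F S g x and t :: nat
    assume run: "experts_instance P" "iid_payoffs M P F" "naive_exp_run b M F S g x"
    interpret prob_space M using run(2) by (simp add: iid_payoffs_def)
    interpret naive_exp P M F b A S g x by unfold_locales (fact run A \<open>0 < b\<close>)+
    show "\<bar>regret M P x t\<bar> \<le> 4 * suboptimality_const b A * real t powr (1 - 1 / (b + 2))"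
      by (rule abs_regret_le)
  qed
next
  case False
  then show ?thesis
    by (intro exI[of _ 0]) (simp add: iid_payoffs_def prob_space.regret_eq_0_if_subsingleton)
qed

end
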